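(* Let $k\ge1$. Assume that the projected hydrostatic equilibrium satisfies, for all $j$ and all $x\in\mathbb S_j$, $\rho_h^e(x)>0$ and $\mathbf z^\top\mathbf p_h^e(x)\mathbf z>0$ for all $\mathbf z\in\mathbb R^2\setminus\{\mathbf 0\}$, and that the numerical solution satisfies $\mathbf U_h(x)\in\mathcal G$ for all $x\in\mathbb S_j$ and all $j$. Then the cell averages updated by the one-dimensional well-balanced DG scheme satisfy $$\overline{\mathbf U}_j^{\rm new}\in\mathcal G\qquad\forall j,$$ under the CFL-type condition (for all $j$) $$\Delta t\left(\frac{\max\{\eta_{1,j+\frac12}^{*,-},\eta_{1,j-\frac12}^{*,+}\}}{\widehat\omega_1h_j}+\beta_{11,j}\right)\le1,$$ where $$\eta_{1,j+\frac12}^{*,-}=\frac{2}{\xi_*(\mathbf U_{j+\frac12}^-)}\max_{\mathbf U\in\{\widehat{\mathbf U}_{j+\frac12}^-,\widehat{\mathbf U}_{j+\frac12}^+,\widehat{\mathbf U}_{j-\frac12}^+\}}\alpha_1(\mathbf U),\qquad \eta_{1,j-\frac12}^{*,+}=\frac{2}{\xi_*(\mathbf U_{j-\frac12}^+)}\max_{\mathbf U\in\{\widehat{\mathbf U}_{j-\frac12}^+,\widehat{\mathbf U}_{j+\frac12}^-,\widehat{\mathbf U}_{j-\frac12}^-\}}\alpha_1(\mathbf U),$$ $$\beta_{11,j}=\max_{1\le\mu\le N}\left|\frac{(p_{11,h}^e)_x(x_j^{(\mu)})}{\rho_h^e(x_j^{(\mu)})}\delta_1(\mathbf U_h(x_j^{(\mu)}))\right|+\left|\alpha_{11,j}\,\delta_1(\overline{\mathbf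 U}_j)\right|,$$ $$\alpha_{11,j}=\frac{p_{11,j+\frac12}^{e,*}-p_{11,j-\frac12}^{e,*}-p_{11,h}^e(x_{j+\frac12}^-)+p_{11,h}^e(x_{j-\frac12}^+)}{h_j\overline{(\rho_h^e)}_j}.$$
   Context: **States.** A state is $\mathbf U=(\rho,m_1,m_2,E_{11},E_{12},E_{22})^\top\in\mathbb R^6$, with $\mathbf m=(m_1,m_2)^\top$ and $\mathbf E$ the symmetric $2\times2$ matrix with entries $E_{11},E_{12},E_{22}$. For $\rho>0$ put $\mathbf u=\mathbf m/\rho$, $\mathbf p=(p_{ij})=2\mathbf E-\mathbf m\mathbf m^\top/\rho$. $\mathcal G=\{\mathbf U:\rho>0,\ \mathbf p\text{ positive-definite}\}$ (a convex set). For $\mathbf U\in\mathcal G$: $\alpha_1(\mathbf U)=|u_1|+\sqrt{3p_{11}/\rho}$ and $\delta_1(\mathbf U)=\max\big\{\sqrt{\rho/p_{11}},\sqrt{\rho p_{22}/\det\mathbf p}\big\}$. **HLLC flux.** $\mathbf F^{hllc}:\mathcal G\times\mathcal G\to\mathbb R^6$ is the HLLC numerical flux of the ten-moment Gaussian closure system in the $x$-direction. Known property: for $\mathbf U_L,\mathbf U_M,\mathbf U_R\in\mathcal G$ and $\lambda>0$ with $\lambda\max_{\mathbf U\in\{\mathbf U_L,\mathbf U_M,\mathbf U_R\}}\alpha_1(\mathbf U)\le\frac12$, one has $\mathbf U_M-\lambda(\mathbf F^{hllc}(\mathbf U_M,\mathbf U_R)-\mathbf F^{hllc}(\mathbf U_L,\mathbf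 U_M))\in\mathcal G$. **Mesh.** Cells $I_j=(x_{j-1/2},x_{j+1/2})$ of length $h_j$; $\mathbb V_h^k$: piecewise polynomials of degree $\le k$; superscripts $\mp$ at $x_{j+1/2}$ are left/right limits; every cell has neighbours $I_{j\pm1}$ (ghost cells at the boundary, satisfying the same hypotheses). $\overline{(\cdot)}_j$: cell average over $I_j$. $\{x_j^{(\mu)},\omega_\mu\}_{\mu=1}^N$: $N$-point Gauss rule on $I_j$ ($\sum_\mu\omega_\mu=1$), exact for degree $\le k$ (i.e. $2N-1\ge k$). $\{\widehat x_j^{(\nu)},\widehat\omega_\nu\}_{\nu=1}^L$: $L$-point Gauss–Lobatto rule on $I_j$, $L=\lceil\frac{k+3}2\rceil$, with $\widehat x_j^{(1)}=x_{j-\frac12}$, $\widehat x_j^{(L)}=x_{j+\frac12}$, $\sum_\nu\widehat\omega_\nu=1$, $\widehat\omega_1=\widehat\omega_L=\frac1{L(L-1)}$. $\mathbb S_j=\{\widehat x_j^{(\nu)}\}_{\nu=1}^L\cup\{x_j^{(\mu)}\}_{\mu=1}^N$; values at points of $\mathbb S_j$ are taken from inside $I_j$. **Projected equilibrium.** $\rho_h^e,p_{11,h}^e,p_{22,h}^e\in\mathbb V_h^k$ are given (projections of a hydrostatic equilibrium with constant $p_{12}^e=C_0$), $\mathbf p_h^e=\begin{pmatrix}p_{11,h}^e&C_0\\C_0&p_{22,h}^e\end{pmatrix}$. Put $p_{11,j+\frac12}^{e,*}=\max\{p_{11,h}^e(x_{j+\frac12}^-),p_{11,h}^e(x_{j+\frac12}^+)\}$,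 $\mathbf p_{j+\frac12}^{e,\pm,*}=\begin{pmatrix}p_{11,j+\frac12}^{e,*}&C_0\\C_0&p_{22,h}^e(x_{j+\frac12}^\pm)\end{pmatrix}$ and $$\mathbf T_{j+\frac12}^\pm=\begin{pmatrix}t_1^\pm&t_2^\pm\\0&1\end{pmatrix},\quad t_1^\pm=\sqrt{\frac{\det\mathbf p_{j+\frac12}^{e,\pm,*}}{\det\mathbf p_h^e(x_{j+\frac12}^\pm)}},\quad t_2^\pm=\frac{C_0(1-t_1^\pm)}{p_{22,h}^e(x_{j+\frac12}^\pm)}.$$ **Modified states.** For $\mathbf U_{j+\frac12}^\pm=\mathbf U_h(x_{j+\frac12}^\pm)$, $\widehat{\mathbf U}_{j+\frac12}^\pm$ has $\widehat\rho=\rho$, $\widehat{\mathbf m}=\mathbf T\mathbf m$, $\widehat{\mathbf E}=\mathbf T\mathbf E\mathbf T^\top$ with $\mathbf T=\mathbf T_{j+\frac12}^\pm$; $\widehat{\mathbf F}_{j+\frac12}=\mathbf F^{hllc}(\widehat{\mathbf U}_{j+\frac12}^-,\widehat{\mathbf U}_{j+\frac12}^+)$. **The quantity $\xi_*$.** For $\mathbf U\in\mathcal G$ transformed with $\mathbf T=\begin{pmatrix}t_1&t_2\\0&1\end{pmatrix}$, let $q=((1-t_1)m_1-t_2m_2)^2$, $f^{(1)}=\|\mathbf p^{-1/2}\mathbf T\mathbf p^{1/2}\|_2^2$, $f^{(2)}=\frac{q}{\rho p_{11}}$, $f^{(3)}=\frac{q\,p_{22}}{\rho\det\mathbf p}$,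 $\theta_{1,\ell}=\frac12\big(\sqrt{(f^{(1)}+f^{(\ell)}-1)^2+4f^{(\ell)}}-(f^{(1)}+f^{(\ell)}-1)\big)$ for $\ell=2,3$, $\theta_*=\max\{\theta_{1,2},\theta_{1,3}\}$, and $\xi_*(\mathbf U)=\frac{1-\theta_*}{f^{(1)}}$. For $\xi_*(\mathbf U_{j+\frac12}^-)$ and $\xi_*(\mathbf U_{j-\frac12}^+)$ the matrices are $\mathbf T_{j+\frac12}^-$ and $\mathbf T_{j-\frac12}^+$, respectively. **Cell-average update** (the scheme with forward Euler step and test function $v=1$): with $\mathbf S_1(\mathbf U)=(0,\rho,0,m_1,\tfrac12m_2,0)^\top$ and $\Delta t>0$, $$\overline{\mathbf U}_j^{\rm new}=\overline{\mathbf U}_j-\frac{\Delta t}{h_j}\big(\widehat{\mathbf F}_{j+\frac12}-\widehat{\mathbf F}_{j-\frac12}\big)+\Delta t\,\overline{\mathbf S}_j^x,$$ $$\overline{\mathbf S}_j^x=\sum_{\mu=1}^N\omega_\mu\Big(\frac{\mathbf S_1(\mathbf U_h(x_j^{(\mu)}))}{\rho_h^e(x_j^{(\mu)})}-\frac{\mathbf S_1(\overline{\mathbf U}_j)}{\overline{(\rho_h^e)}_j}\Big)(p_{11,h}^e)_x(x_j^{(\mu)})+\frac{p_{11,j+\frac12}^{e,*}-p_{11,j-\frac12}^{e,*}}{h_j\overline{(\rho_h^e)}_j}\mathbf S_1(\overline{\mathbf U}_j).$$ *)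

theory Defs
  imports "HOL-Analysis.Analysis" "HOL-Computational_Algebra.Polynomial"
begin

section \<open>States of the ten-moment system\<close>

text \<open>A state is the vector $(\rho, m_1, m_2, E_{11}, E_{12}, E_{22})$.\<close>

type_synonym state = "real^6"

definition dens :: "state \<Rightarrow> real" where
  "dens U = U $ 1"

definition mom :: "state \<Rightarrow> real^2" where
  "mom U = vector [U $ 2, U $ 3]"

definition energy :: "state \<Rightarrow> real^2^2" where
  "energy U = vector [vector [U $ 4, U $ 5], vector [U $ 5, U $ 6]]"

definition pressure :: "state \<Rightarrow> real^2^2" where
  "pressure U = (\<chi> i j. 2 * energy U $ i $ j - mom U $ i * mom U $ j / dens U)"

definition pos_def :: "real^2^2 \<Rightarrow> bool" where
  "pos_def A \<longleftrightarrow> transpose A = A \<and> (\<forall>z. z \<noteq> 0 \<longrightarrow> z \<bullet> (A *v z) > 0)"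

definition admissible :: "state set" where
  "admissible = {U. dens U > 0 \<and> pos_def (pressure U)}"

definition alpha1 :: "state \<Rightarrow> real" where
  "alpha1 U = \<bar>mom U $ 1 / dens U\<bar> + sqrt (3 * pressure U $ 1 $ 1 / dens U)"

definition delta1 :: "state \<Rightarrow> real" where
  "delta1 U = max (sqrt (dens U / pressure U $ 1 $ 1))
                  (sqrt (dens U * pressure U $ 2 $ 2 / det (pressure U)))"

definition S1 :: "state \<Rightarrow> state" where
  "S1 U = vector [0, dens U, 0, mom U $ 1, mom U $ 2 / 2, 0]"

definition transform :: "real^2^2 \<Rightarrow> state \<Rightarrow> state" where
  "transform T U =
     (let m = T *v mom U; E = T ** energy U ** transpose T
      in vector [dens U, m $ 1, m $ 2, E $ 1 $ 1, E $ 1 $ 2, E $ 2 $ 2])"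

text \<open>
  The only fact about the HLLC flux used here is the following positivity property. A flux is
  represented by a total function; only its values on admissible states are constrained.
\<close>

definition positivity_preserving_flux :: "(state \<Rightarrow> state \<Rightarrow> state) \<Rightarrow> bool" where
  "positivity_preserving_flux F \<longleftrightarrow>
     (\<forall>UL\<in>admissible. \<forall>UM\<in>admissible. \<forall>UR\<in>admissible. \<forall>lam>0.
        lam * Max (alpha1 ` {UL, UM, UR}) \<le> 1/2 \<longrightarrow>
        UM - lam *\<^sub>R (F UM UR - F UL UM) \<in> admissible)"

section \<open>The quantity \<open>\<xi>\<^sub>*\<close>\<close>

text \<open>The symmetric positive-definite square root of a positive-definite matrix.\<close>

definition spd_sqrt :: "real^2^2 \<Rightarrow> real^2^2" where
  "spd_sqrt A = (THE B. pos_def B \<and> B ** B = A)"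

definition f1 :: "real^2^2 \<Rightarrow> state \<Rightarrow> real" where
  "f1 T U = (onorm (\<lambda>z. (matrix_inv (spd_sqrt (pressure U)) ** T ** spd_sqrt (pressure U)) *v z))\<^sup>2"

definition q_defect :: "real^2^2 \<Rightarrow> state \<Rightarrow> real" where
  "q_defect T U = ((1 - T $ 1 $ 1) * mom U $ 1 - T $ 1 $ 2 * mom U $ 2)\<^sup>2"

definition f2 :: "real^2^2 \<Rightarrow> state \<Rightarrow> real" where
  "f2 T U = q_defect T U / (dens U * pressure U $ 1 $ 1)"

definition f3 :: "real^2^2 \<Rightarrow> state \<Rightarrow> real" where
  "f3 T U = q_defect T U * pressure U $ 2 $ 2 / (dens U * det (pressure U))"

definition theta_root :: "real \<Rightarrow> real \<Rightarrow> real" where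
  "theta_root a b = (sqrt ((a + b - 1)\<^sup>2 + 4 * b) - (a + b - 1)) / 2"

definition theta_star :: "real^2^2 \<Rightarrow> state \<Rightarrow> real" where
  "theta_star T U = max (theta_root (f1 T U) (f2 T U)) (theta_root (f1 T U) (f3 T U))"

definition xi_star :: "real^2^2 \<Rightarrow> state \<Rightarrow> real" where
  "xi_star T U = (1 - theta_star T U) / f1 T U"

section \<open>Quadrature rules\<close>

text \<open>Nodes and weights are indexed from 1. Weights are normalised: exactness is required for
  the mean value over \<open>[a, b]\<close>, so the weights sum to 1.\<close>

definition exact_mean_rule ::
  "real \<Rightarrow> real \<Rightarrow> nat \<Rightarrow> (nat \<Rightarrow> real) \<Rightarrow> (nat \<Rightarrow> real) \<Rightarrow> nat \<Rightarrow> bool" where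
  "exact_mean_rule a b n x w d \<longleftrightarrow>
     (\<forall>p :: real poly. degree p \<le> d \<longrightarrow>
        (\<Sum>i=1..n. w i * poly p (x i)) = integral {a..b} (poly p) / (b - a))"

text \<open>The \<open>n\<close>-point Gauss rule is the \<open>n\<close>-point rule of degree of exactness \<open>2n - 1\<close>.\<close>

definition gauss_rule :: "real \<Rightarrow> real \<Rightarrow> nat \<Rightarrow> (nat \<Rightarrow> real) \<Rightarrow> (nat \<Rightarrow> real) \<Rightarrow> bool" where
  "gauss_rule a b n x w \<longleftrightarrow>
     strict_mono_on {1..n} x \<and> x ` {1..n} \<subseteq> {a<..<b} \<and> exact_mean_rule a b n x w (2 * n - 1)"

text \<open>The \<open>n\<close>-point Gauss--Lobatto rule is the \<open>n\<close>-point rule containing both end points and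
  having degree of exactness \<open>2n - 3\<close>. The values of the end-point weights
  are a consequence of this and are recorded for convenience.\<close>

definition lobatto_rule :: "real \<Rightarrow> real \<Rightarrow> nat \<Rightarrow> (nat \<Rightarrow> real) \<Rightarrow> (nat \<Rightarrow> real) \<Rightarrow> bool" where
  "lobatto_rule a b n x w \<longleftrightarrow>
     2 \<le> n \<and> strict_mono_on {1..n} x \<and> x 1 = a \<and> x n = b \<and>
     exact_mean_rule a b n x w (2 * n - 3) \<and>
     w 1 = 1 / (real n * (real n - 1)) \<and> w n = 1 / (real n * (real n - 1))"

definition lobatto_num :: "nat \<Rightarrow> nat" where
  "lobatto_num k = nat \<lceil>(real k + 3) / 2\<rceil>"

section \<open>Data of the scheme\<close>

text \<open>
  Cell \<open>j\<close> is the interval between the interfaces \<open>x\<^bsub>j-1/2\<^esub>\<close> and \<open>x\<^bsub>j+1/2\<^esub>\<close>; the interface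
  \<open>x\<^bsub>j+1/2\<^esub>\<close> is \<open>iface D j\<close>. A piecewise polynomial is given by its polynomial on each
  cell, so its left and right limits at \<open>x\<^bsub>j+1/2\<^esub>\<close> are the values there of the polynomials of the
  cells \<open>j\<close> and \<open>j + 1\<close>. The fields \<open>gauss_pt\<close>, \<open>lob_pt\<close> take the cell and then the node index.
\<close>

record dg_data =
  iface :: "int \<Rightarrow> real"
  gauss_num :: nat
  gauss_pt :: "int \<Rightarrow> nat \<Rightarrow> real"
  gauss_wt :: "nat \<Rightarrow> real"
  lob_pt :: "int \<Rightarrow> nat \<Rightarrow> real"
  lob_wt :: "nat \<Rightarrow> real"
  rho_e :: "int \<Rightarrow> real poly"
  p11_e :: "int \<Rightarrow> real poly"
  p22_e :: "int \<Rightarrow> real poly"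
  C0 :: real
  U_h :: "int \<Rightarrow> (real poly)^6"
  flux :: "state \<Rightarrow> state \<Rightarrow> state"

definition cell_len :: "dg_data \<Rightarrow> int \<Rightarrow> real" where
  "cell_len D j = iface D j - iface D (j - 1)"

definition cell_avg :: "dg_data \<Rightarrow> int \<Rightarrow> (real \<Rightarrow> 'a::euclidean_space) \<Rightarrow> 'a" where
  "cell_avg D j f = (1 / cell_len D j) *\<^sub>R integral {iface D (j - 1)..iface D j} f"

text \<open>The points of \<open>\<bbbS>\<^sub>j\<close>, for polynomial degree \<open>k\<close>.\<close>

definition nodes :: "dg_data \<Rightarrow> nat \<Rightarrow> int \<Rightarrow> real set" where
  "nodes D k j = lob_pt D j ` {1..lobatto_num k} \<union> gauss_pt D j ` {1..gauss_num D}"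

definition U_val :: "dg_data \<Rightarrow> int \<Rightarrow> real \<Rightarrow> state" where
  "U_val D j x = (\<chi> i. poly (U_h D j $ i) x)"

definition U_avg :: "dg_data \<Rightarrow> int \<Rightarrow> state" where
  "U_avg D j = cell_avg D j (U_val D j)"

definition rho_e_avg :: "dg_data \<Rightarrow> int \<Rightarrow> real" where
  "rho_e_avg D j = cell_avg D j (poly (rho_e D j))"

definition p_e :: "dg_data \<Rightarrow> int \<Rightarrow> real \<Rightarrow> real^2^2" where
  "p_e D j x = vector [vector [poly (p11_e D j) x, C0 D], vector [C0 D, poly (p22_e D j) x]]"

section \<open>Interface quantities\<close>

definition p11_star :: "dg_data \<Rightarrow> int \<Rightarrow> real" where
  "p11_star D j = max (poly (p11_e D j) (iface D j)) (poly (p11_e D (j + 1)) (iface D j))"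

text \<open>In the following two definitions \<open>c\<close> is the cell on whose side of \<open>x\<^bsub>j+1/2\<^esub>\<close> the traces are
  taken: \<open>c = j\<close> for the superscript \<open>-\<close>, and \<open>c = j + 1\<close> for \<open>+\<close>.\<close>

definition p_e_star :: "dg_data \<Rightarrow> int \<Rightarrow> int \<Rightarrow> real^2^2" where
  "p_e_star D j c =
     vector [vector [p11_star D j, C0 D], vector [C0 D, poly (p22_e D c) (iface D j)]]"

definition T_side :: "dg_data \<Rightarrow> int \<Rightarrow> int \<Rightarrow> real^2^2" where
  "T_side D j c =
     (let t1 = sqrt (det (p_e_star D j c) / det (p_e D c (iface D j)));
          t2 = C0 D * (1 - t1) / poly (p22_e D c) (iface D j)
      in vector [vector [t1, t2], vector [0, 1]])"

definition T_minus :: "dg_data \<Rightarrow> int \<Rightarrow> real^2^2" where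
  "T_minus D j = T_side D j j"

definition T_plus :: "dg_data \<Rightarrow> int \<Rightarrow> real^2^2" where
  "T_plus D j = T_side D j (j + 1)"

definition U_minus :: "dg_data \<Rightarrow> int \<Rightarrow> state" where
  "U_minus D j = U_val D j (iface D j)"

definition U_plus :: "dg_data \<Rightarrow> int \<Rightarrow> state" where
  "U_plus D j = U_val D (j + 1) (iface D j)"

definition Uhat_minus :: "dg_data \<Rightarrow> int \<Rightarrow> state" where
  "Uhat_minus D j = transform (T_minus D j) (U_minus D j)"

definition Uhat_plus :: "dg_data \<Rightarrow> int \<Rightarrow> state" where
  "Uhat_plus D j = transform (T_plus D j) (U_plus D j)"

definition Fhat :: "dg_data \<Rightarrow> int \<Rightarrow> state" where
  "Fhat D j = flux D (Uhat_minus D j) (Uhat_plus D j)"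

section \<open>The cell-average update\<close>

definition source_avg :: "dg_data \<Rightarrow> int \<Rightarrow> state" where
  "source_avg D j =
     (\<Sum>\<mu>=1..gauss_num D.
        (gauss_wt D \<mu> * poly (pderiv (p11_e D j)) (gauss_pt D j \<mu>)) *\<^sub>R
          ((1 / poly (rho_e D j) (gauss_pt D j \<mu>)) *\<^sub>R S1 (U_val D j (gauss_pt D j \<mu>))
            - (1 / rho_e_avg D j) *\<^sub>R S1 (U_avg D j)))
     + ((p11_star D j - p11_star D (j - 1)) / (cell_len D j * rho_e_avg D j)) *\<^sub>R S1 (U_avg D j)"

definition U_new :: "dg_data \<Rightarrow> real \<Rightarrow> int \<Rightarrow> state" where
  "U_new D dt j =
     U_avg D j - (dt / cell_len D j) *\<^sub>R (Fhat D j - Fhat D (j - 1)) + dt *\<^sub>R source_avg D j"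

section \<open>Quantities in the CFL condition\<close>

text \<open>\<open>eta_minus D j\<close> is $\eta^{*,-}_{1,j+1/2}$ and \<open>eta_plus D j\<close> is $\eta^{*,+}_{1,j-1/2}$:
  both belong to cell \<open>j\<close>.\<close>

definition eta_minus :: "dg_data \<Rightarrow> int \<Rightarrow> real" where
  "eta_minus D j = 2 / xi_star (T_minus D j) (U_minus D j) *
     Max (alpha1 ` {Uhat_minus D j, Uhat_plus D j, Uhat_plus D (j - 1)})"

definition eta_plus :: "dg_data \<Rightarrow> int \<Rightarrow> real" where
  "eta_plus D j = 2 / xi_star (T_plus D (j - 1)) (U_plus D (j - 1)) *
     Max (alpha1 ` {Uhat_plus D (j - 1), Uhat_minus D j, Uhat_minus D (j - 1)})"

definition alpha11 :: "dg_data \<Rightarrow> int \<Rightarrow> real" where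
  "alpha11 D j =
     (p11_star D j - p11_star D (j - 1)
       - poly (p11_e D j) (iface D j) + poly (p11_e D j) (iface D (j - 1)))
     / (cell_len D j * rho_e_avg D j)"

definition beta11 :: "dg_data \<Rightarrow> int \<Rightarrow> real" where
  "beta11 D j =
     Max ((\<lambda>\<mu>. \<bar>poly (pderiv (p11_e D j)) (gauss_pt D j \<mu>) / poly (rho_e D j) (gauss_pt D j \<mu>)
               * delta1 (U_val D j (gauss_pt D j \<mu>))\<bar>) ` {1..gauss_num D})
     + \<bar>alpha11 D j * delta1 (U_avg D j)\<bar>"

end

theory Submission
  imports Defs
begin

text \<open>
  A state is admissible iff the symmetric block matrix with rows \<open>(\<rho>, m\<^sup>T)\<close> and \<open>(m, 2E)\<close> is
  positive definite (Schur complement), so admissible states form an open convex cone with linear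
  defining inequalities. Replacing \<open>(m, E)\<close> by \<open>(T m, T E T\<^sup>T)\<close> is a congruence of this matrix,
  and \<open>\<xi>\<^sub>*\<close> is chosen such that \<open>U - \<xi>\<^sub>* V\<close> is positive semidefinite, where \<open>V\<close> is the transformed
  state. Likewise \<open>\<beta> U + c S1 U\<close> is positive semidefinite when \<open>\<bar>c\<bar> \<delta>\<^sub>1(U) \<le> \<beta>\<close>. The cell average
  splits by the Lobatto rule into traces and interior values; the end-point share
  \<open>\<omega>\<^sub>1 \<xi>\<^sub>* V\<close> of the two traces, with the flux between the two modified inner traces added and
  subtracted, pays for the numerical fluxes, and the share \<open>\<beta>\<close> of the average,
  written with the Gauss rule, pays for the source.
\<close>

section \<open>Admissible states as positive-definite forms\<close>

lemma vector_6 [simp]: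
  "(vector [a, b, c, d, e, f] :: real^6) $ 1 = a"
  "(vector [a, b, c, d, e, f] :: real^6) $ 2 = b"
  "(vector [a, b, c, d, e, f] :: real^6) $ 3 = c"
  "(vector [a, b, c, d, e, f] :: real^6) $ 4 = d"
  "(vector [a, b, c, d, e, f] :: real^6) $ 5 = e"
  "(vector [a, b, c, d, e, f] :: real^6) $ 6 = f"
  by (simp_all add: vector_def)

text \<open>The quadratic form of the block matrix with rows \<open>(\<rho>, m\<^sup>T)\<close> and \<open>(m, 2E)\<close>.\<close>

definition state_form :: "state \<Rightarrow> real \<Rightarrow> real \<Rightarrow> real \<Rightarrow> real" where
  "state_form U s a b = U $ 1 * s\<^sup>2 + 2 * s * (U $ 2 * a + U $ 3 * b)
     + 2 * (U $ 4 * a\<^sup>2 + 2 * U $ 5 * a * b + U $ 6 * b\<^sup>2)"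

text \<open>Semidefinite counterpart of admissibility, with zero density allowed: a closed cone for
  the remainder terms that get added to an admissible state.\<close>

definition nonneg_state :: "state \<Rightarrow> bool" where
  "nonneg_state U \<longleftrightarrow> (\<forall>s a b. 0 \<le> state_form U s a b)"

definition quad_form :: "real^2^2 \<Rightarrow> real \<Rightarrow> real \<Rightarrow> real" where
  "quad_form A a b = A $ 1 $ 1 * a\<^sup>2 + 2 * A $ 1 $ 2 * a * b + A $ 2 $ 2 * b\<^sup>2"

lemma state_form_add: "state_form (U + V) s a b = state_form U s a b + state_form V s a b"
  by (simp add: state_form_def algebra_simps)

lemma state_form_scaleR: "state_form (c *\<^sub>R U) s a b = c * state_form U s a b"
  by (simp add: state_form_def algebra_simps)

lemma nonneg_state_add: "nonneg_state U \<Longrightarrow> nonneg_state V \<Longrightarrow> nonneg_state (U + V)"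
  by (simp add: nonneg_state_def state_form_add)

lemma nonneg_state_scaleR: "0 \<le> c \<Longrightarrow> nonneg_state U \<Longrightarrow> nonneg_state (c *\<^sub>R U)"
  by (simp add: nonneg_state_def state_form_scaleR)

lemma nonneg_state_0: "nonneg_state 0"
  by (simp add: nonneg_state_def state_form_def)

lemma nonneg_state_sum: "(\<And>i. i \<in> A \<Longrightarrow> nonneg_state (f i)) \<Longrightarrow> nonneg_state (sum f A)"
  by (induction A rule: infinite_finite_induct) (auto intro: nonneg_state_0 nonneg_state_add)

lemma quad_form_eq_inner:
  assumes "A $ 1 $ 2 = A $ 2 $ 1"
  shows "z \<bullet> (A *v z) = quad_form A (z $ 1) (z $ 2)"
  using assms
  by (simp add: quad_form_def inner_vec_def matrix_vector_mult_def sum_2 algebra_simps power2_eq_square)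

lemma pos_def_iff:
  "pos_def A \<longleftrightarrow> A $ 1 $ 2 = A $ 2 $ 1 \<and> (\<forall>a b. a \<noteq> 0 \<or> b \<noteq> 0 \<longrightarrow> 0 < quad_form A a b)"
proof -
  have sym: "transpose A = A \<longleftrightarrow> A $ 1 $ 2 = A $ 2 $ 1"
    by (auto simp: vec_eq_iff transpose_def forall_2)
  have "(\<forall>z. z \<noteq> 0 \<longrightarrow> z \<bullet> (A *v z) > 0)
      \<longleftrightarrow> (\<forall>a b. a \<noteq> 0 \<or> b \<noteq> 0 \<longrightarrow> 0 < quad_form A a b)" if "A $ 1 $ 2 = A $ 2 $ 1"
    unfolding forall_vector_2 by (simp add: quad_form_eq_inner[OF that] vec_eq_iff forall_2)
  with sym show ?thesis unfolding pos_def_def by blast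
qed

lemma pos_def_diag_pos:
  assumes "pos_def A"
  shows "A $ 1 $ 1 > 0" "A $ 2 $ 2 > 0"
proof -
  have "0 < quad_form A 1 0" "0 < quad_form A 0 1" using assms unfolding pos_def_iff by auto
  then show "A $ 1 $ 1 > 0" "A $ 2 $ 2 > 0" by (simp_all add: quad_form_def)
qed

lemma pos_def_det_pos:
  assumes "pos_def A"
  shows "det A > 0"
proof -
  have sym: "A $ 1 $ 2 = A $ 2 $ 1" using assms by (simp add: pos_def_iff)
  \<comment> \<open>This vector makes the second component of A z vanish, so the form factors
    through the determinant.\<close>
  have "0 < quad_form A (A $ 2 $ 2) (- (A $ 1 $ 2))"
    using assms pos_def_diag_pos[OF assms] unfolding pos_def_iff by simp
  also have "\<dots> = A $ 2 $ 2 * det A"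
    by (simp add: quad_form_def det_2 sym algebra_simps power2_eq_square)
  finally show ?thesis using pos_def_diag_pos[OF assms] by (simp add: zero_less_mult_iff)
qed

text \<open>Completing the square in b. For the pressure p this bounds a^2 by the form times p22 /
  det p, the (1,1) entry of the inverse of p; the same ratio appears in \<open>delta1\<close> and
  \<open>f3\<close>.\<close>

lemma det_le_quad_form:
  assumes "A $ 1 $ 2 = A $ 2 $ 1"
  shows "a\<^sup>2 * det A \<le> A $ 2 $ 2 * quad_form A a b"
proof -
  have "A $ 2 $ 2 * quad_form A a b = a\<^sup>2 * det A + (A $ 1 $ 2 * a + A $ 2 $ 2 * b)\<^sup>2"
    using assms by (simp add: quad_form_def det_2 algebra_simps power2_eq_square)
  then show ?thesis by simp
qed

lemma pressure_nth:
  "pressure U $ 1 $ 1 = 2 * U $ 4 - U $ 2 * U $ 2 / U $ 1"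
  "pressure U $ 1 $ 2 = 2 * U $ 5 - U $ 2 * U $ 3 / U $ 1"
  "pressure U $ 2 $ 1 = 2 * U $ 5 - U $ 3 * U $ 2 / U $ 1"
  "pressure U $ 2 $ 2 = 2 * U $ 6 - U $ 3 * U $ 3 / U $ 1"
  by (simp_all add: pressure_def energy_def mom_def dens_def)

text \<open>Completing the square in s: the Schur complement of the density in the block matrix is
  the pressure.\<close>

lemma state_form_complete_square:
  assumes "U $ 1 \<noteq> 0"
  shows "U $ 1 * state_form U s a b
    = (U $ 1 * s + U $ 2 * a + U $ 3 * b)\<^sup>2 + U $ 1 * quad_form (pressure U) a b"
  using assms by (simp add: state_form_def quad_form_def pressure_nth field_simps power2_eq_square)

lemma admissible_iff:
  "U \<in> admissible \<longleftrightarrow> (\<forall>s a b. s \<noteq> 0 \<or> a \<noteq> 0 \<or> b \<noteq> 0 \<longrightarrow> 0 < state_form U s a b)"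
    (is "_ \<longleftrightarrow> ?P")
proof
  assume U: "U \<in> admissible"
  then have pos: "U $ 1 > 0" and p: "\<And>a b. a \<noteq> 0 \<or> b \<noteq> 0 \<Longrightarrow> 0 < quad_form (pressure U) a b"
    by (auto simp: admissible_def dens_def pos_def_iff)
  show ?P
  proof (intro allI impI)
    fix s a b :: real
    assume nz: "s \<noteq> 0 \<or> a \<noteq> 0 \<or> b \<noteq> 0"
    have "0 < U $ 1 * state_form U s a b"
    proof (cases "a \<noteq> 0 \<or> b \<noteq> 0")
      case True
      then show ?thesis using p[OF True] pos state_form_complete_square[of U s a b]
        by (simp add: add_nonneg_pos)
    next
      case False
      then show ?thesis using nz pos by (simp add: state_form_def)
    qed
    then show "0 < state_form U s a b" using pos by (simp add: zero_less_mult_iff)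
  qed
next
  assume P: ?P
  have "0 < state_form U 1 0 0" using P by simp
  then have pos: "U $ 1 > 0" by (simp add: state_form_def)
  have "0 < quad_form (pressure U) a b" if "a \<noteq> 0 \<or> b \<noteq> 0" for a b
  proof -
    \<comment> \<open>This s cancels the completed square and leaves only the pressure form.\<close>
    let ?s = "- (U $ 2 * a + U $ 3 * b) / U $ 1"
    have "0 < U $ 1 * state_form U ?s a b" using P that pos by simp
    also have "\<dots> = U $ 1 * quad_form (pressure U) a b"
      using pos by (simp add: state_form_complete_square)
    finally show ?thesis using pos by (simp add: zero_less_mult_iff)
  qed
  with pos show "U \<in> admissible"
    by (simp add: admissible_def dens_def pos_def_iff pressure_nth)
qed

lemma nonneg_state_admissible: "U \<in> admissible \<Longrightarrow> nonneg_state U"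
  unfolding nonneg_state_def admissible_iff
  by (metis (no_types, lifting) add_0 less_eq_real_def mult_zero_right power_zero_numeral state_form_def)

lemma admissible_add: "U \<in> admissible \<Longrightarrow> nonneg_state V \<Longrightarrow> U + V \<in> admissible"
  by (simp add: admissible_iff nonneg_state_def state_form_add add_pos_nonneg)

lemma admissible_scaleR: "0 < c \<Longrightarrow> U \<in> admissible \<Longrightarrow> c *\<^sub>R U \<in> admissible"
  by (simp add: admissible_iff state_form_scaleR)

lemma alpha1_pos:
  assumes "U \<in> admissible"
  shows "0 < alpha1 U"
  using assms pos_def_diag_pos(1)[of "pressure U"]
  by (simp add: alpha1_def admissible_def add_nonneg_pos)

section \<open>The source term\<close>

text \<open>The second factor is the linear expression squared in
  \<open>state_form_complete_square\<close>, so a product inequality can absorb the source into the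
  form of the state.\<close>

lemma state_form_S1:
  "state_form (S1 U) s a b = 2 * a * (U $ 1 * s + U $ 2 * a + U $ 3 * b)"
  by (simp add: state_form_def S1_def dens_def mom_def algebra_simps power2_eq_square)

text \<open>The source form is 2 c a X. By the arithmetic-geometric mean inequality, 2 r \<rho> |a|
  |X| is at most r^2 X^2 + \<rho>^2 a^2, and \<open>det_le_quad_form\<close> bounds \<rho>^2 a^2 by
  r^2 \<rho> times the pressure form. Together these give r^2 \<rho> times the state form.\<close>

lemma nonneg_state_source:
  assumes U: "U \<in> admissible" and le: "\<bar>c * delta1 U\<bar> \<le> \<beta>"
  shows "nonneg_state (\<beta> *\<^sub>R U + c *\<^sub>R S1 U)"
  unfolding nonneg_state_def
proof (intro allI)
  fix s a b :: real
  define X where "X = U $ 1 * s + U $ 2 * a + U $ 3 * b"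
  define p22 where "p22 = pressure U $ 2 $ 2"
  define d where "d = det (pressure U)"
  \<comment> \<open>The second entry of the maximum in \<open>delta1\<close>; r^2 is \<rho> times
    the (1,1) entry of the inverse pressure.\<close>
  define r where "r = sqrt (U $ 1 * p22 / d)"
  have \<rho>: "U $ 1 > 0" and pd: "pos_def (pressure U)"
    using U by (auto simp: admissible_def dens_def)
  have p22: "p22 > 0" and d: "d > 0"
    using pos_def_diag_pos[OF pd] pos_def_det_pos[OF pd] by (auto simp: p22_def d_def)
  have r: "r > 0" using \<rho> p22 d by (simp add: r_def)
  have r2: "r\<^sup>2 = U $ 1 * p22 / d" using \<rho> p22 d by (simp add: r_def)
  have rd: "r \<le> delta1 U" by (simp add: delta1_def r_def dens_def p22_def d_def)
  have "\<bar>c\<bar> * r \<le> \<bar>c * delta1 U\<bar>"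
    using rd r by (simp add: abs_mult mult_left_mono)
  then have cr: "\<bar>c\<bar> * r \<le> \<beta>" using le by linarith
  have quad: "a\<^sup>2 * d \<le> p22 * quad_form (pressure U) a b"
    unfolding d_def p22_def using pd by (intro det_le_quad_form) (simp add: pos_def_iff)
  have "(U $ 1 * a)\<^sup>2 = (U $ 1)\<^sup>2 / d * (a\<^sup>2 * d)"
    using d by (simp add: power_mult_distrib)
  also have "\<dots> \<le> (U $ 1)\<^sup>2 / d * (p22 * quad_form (pressure U) a b)"
    using quad d by (intro mult_left_mono) auto
  also have "\<dots> = r\<^sup>2 * (U $ 1 * quad_form (pressure U) a b)"
    unfolding r2 by (simp add: power2_eq_square)
  finally have q2: "(U $ 1 * a)\<^sup>2 \<le> r\<^sup>2 * (U $ 1 * quad_form (pressure U) a b)" .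
  have "0 \<le> (r * \<bar>X\<bar> - U $ 1 * \<bar>a\<bar>)\<^sup>2" by simp
  then have "r * (2 * U $ 1 * \<bar>a\<bar> * \<bar>X\<bar>) \<le> r\<^sup>2 * X\<^sup>2 + (U $ 1 * a)\<^sup>2"
    by (simp add: power2_eq_square algebra_simps)
  also have "\<dots> \<le> r\<^sup>2 * (U $ 1 * state_form U s a b)"
    using q2 \<rho> by (simp add: state_form_complete_square X_def algebra_simps)
  finally have "2 * \<bar>a\<bar> * \<bar>X\<bar> \<le> r * state_form U s a b"
    using r \<rho> by (simp add: power2_eq_square field_simps)
  then have "\<bar>c\<bar> * (2 * \<bar>a\<bar> * \<bar>X\<bar>) \<le> \<bar>c\<bar> * (r * state_form U s a b)"
    by (rule mult_left_mono) simp
  also have "\<dots> = (\<bar>c\<bar> * r) * state_form U s a b" by simp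
  also have "\<dots> \<le> \<beta> * state_form U s a b"
    using cr nonneg_state_admissible[OF U] by (intro mult_right_mono) (auto simp: nonneg_state_def)
  finally have "\<bar>c * (2 * a * X)\<bar> \<le> \<beta> * state_form U s a b" by (simp add: abs_mult)
  then show "0 \<le> state_form (\<beta> *\<^sub>R U + c *\<^sub>R S1 U) s a b"
    by (simp add: state_form_add state_form_scaleR state_form_S1 X_def abs_le_iff)
qed

section \<open>The modified states\<close>

lemma state_form_transform:
  "state_form (transform T U) s a b
     = state_form U s (T $ 1 $ 1 * a + T $ 2 $ 1 * b) (T $ 1 $ 2 * a + T $ 2 $ 2 * b)"
  by (simp add: state_form_def transform_def Let_def dens_def mom_def energy_def
      matrix_vector_mult_def matrix_matrix_mult_def transpose_def sum_2 algebra_simps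
      power2_eq_square)

text \<open>Such a T is invertible, so the congruence maps no nonzero vector to zero.\<close>

lemma transform_admissible:
  assumes "U \<in> admissible" "T $ 1 $ 1 \<noteq> 0" "T $ 2 $ 1 = 0" "T $ 2 $ 2 = 1"
  shows "transform T U \<in> admissible"
  using assms by (auto simp: admissible_iff state_form_transform)

text \<open>The square root is explicit by Cayley--Hamilton.\<close>

lemma pos_def_sqrt_exists:
  assumes A: "pos_def A"
  shows "\<exists>B. pos_def B \<and> B ** B = A"
proof -
  \<comment> \<open>The root B must have determinant d and trace t, so Cayley-Hamilton, t B = A + d
    I, dictates its entries.\<close>
  define d where "d = sqrt (det A)"
  define t where "t = sqrt (A $ 1 $ 1 + A $ 2 $ 2 + 2 * d)"
  define B :: "real^2^2" where
    "B = vector [vector [(A $ 1 $ 1 + d) / t, A $ 1 $ 2 / t], vector [A $ 1 $ 2 / t, (A $ 2 $ 2 + d) / t]]"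
  have sym: "A $ 1 $ 2 = A $ 2 $ 1"
    and pos: "\<And>a b. a \<noteq> 0 \<or> b \<noteq> 0 \<Longrightarrow> 0 < quad_form A a b" using A by (auto simp: pos_def_iff)
  have d: "d > 0" and d2: "d * d = A $ 1 $ 1 * A $ 2 $ 2 - A $ 1 $ 2 * A $ 1 $ 2"
    using pos_def_det_pos[OF A] by (auto simp: d_def det_2 sym)
  have t: "t > 0" and t2: "t * t = A $ 1 $ 1 + A $ 2 $ 2 + 2 * d"
    using pos_def_diag_pos[OF A] d by (auto simp: t_def)
  have "0 < quad_form B a b" if "a \<noteq> 0 \<or> b \<noteq> 0" for a b
  proof -
    have "quad_form B a b = (quad_form A a b + d * (a\<^sup>2 + b\<^sup>2)) / t"
      using t by (simp add: quad_form_def B_def field_simps)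
    then show ?thesis using pos[OF that] d t by (simp add: add_pos_nonneg)
  qed
  then have "pos_def B" by (simp add: pos_def_iff B_def)
  moreover have "B ** B = A"
  proof -
    have "(A $ 1 $ 1 + d) * (A $ 1 $ 1 + d) + A $ 1 $ 2 * A $ 1 $ 2 = A $ 1 $ 1 * (t * t)"
      "(A $ 2 $ 2 + d) * (A $ 2 $ 2 + d) + A $ 1 $ 2 * A $ 1 $ 2 = A $ 2 $ 2 * (t * t)"
      "(A $ 1 $ 1 + d) * A $ 1 $ 2 + A $ 1 $ 2 * (A $ 2 $ 2 + d) = A $ 1 $ 2 * (t * t)"
      unfolding t2 using d2 by (simp_all add: algebra_simps)
    then show ?thesis
      using t by (simp add: vec_eq_iff forall_2 matrix_matrix_mult_def sum_2 B_def sym[symmetric]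
          add_divide_distrib[symmetric] field_simps)
  qed
  ultimately show ?thesis by blast
qed

text \<open>Positivity fixes the determinant of a root from that of A, then its trace from trace A +
  2 det; Cayley-Hamilton recovers the entries. This justifies the definite description in
  \<open>spd_sqrt\<close>.\<close>

lemma pos_def_sqrt_unique:
  assumes B: "pos_def B" and BA: "B ** B = A" and C: "pos_def C" and CA: "C ** C = A"
  shows "B = C"
proof -
  have entries: "A $ 1 $ 1 = X $ 1 $ 1 * X $ 1 $ 1 + X $ 1 $ 2 * X $ 1 $ 2"
      "A $ 2 $ 2 = X $ 1 $ 2 * X $ 1 $ 2 + X $ 2 $ 2 * X $ 2 $ 2"
      "A $ 1 $ 2 = X $ 1 $ 2 * (X $ 1 $ 1 + X $ 2 $ 2)"
      "X $ 1 $ 2 = X $ 2 $ 1"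
      "det A = det X * det X"
    if "pos_def X" "X ** X = A" for X :: "real^2^2"
    using that unfolding that(2)[symmetric]
    by (simp_all add: matrix_matrix_mult_def sum_2 pos_def_iff det_2 algebra_simps)
  have "(det B)\<^sup>2 = (det C)\<^sup>2"
    using entries(5)[OF B BA] entries(5)[OF C CA] by (simp add: power2_eq_square)
  then have d: "det B = det C"
    using pos_def_det_pos[OF B] pos_def_det_pos[OF C] by (simp add: power2_eq_iff_nonneg)
  have tr: "(X $ 1 $ 1 + X $ 2 $ 2)\<^sup>2 = A $ 1 $ 1 + A $ 2 $ 2 + 2 * det X"
    if "pos_def X" "X ** X = A" for X :: "real^2^2"
    using entries(1,2,4)[OF that] by (simp add: det_2 algebra_simps power2_eq_square)
  have "(B $ 1 $ 1 + B $ 2 $ 2)\<^sup>2 = (C $ 1 $ 1 + C $ 2 $ 2)\<^sup>2"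
    using tr[OF B BA] tr[OF C CA] d by simp
  then have t: "B $ 1 $ 1 + B $ 2 $ 2 = C $ 1 $ 1 + C $ 2 $ 2"
    using pos_def_diag_pos[OF B] pos_def_diag_pos[OF C] by (simp add: power2_eq_iff_nonneg)
  have tpos: "C $ 1 $ 1 + C $ 2 $ 2 > 0" using pos_def_diag_pos[OF C] by simp
  have ch: "X $ 1 $ 1 * (X $ 1 $ 1 + X $ 2 $ 2) = A $ 1 $ 1 + det X"
    "X $ 2 $ 2 * (X $ 1 $ 1 + X $ 2 $ 2) = A $ 2 $ 2 + det X"
    if "pos_def X" "X ** X = A" for X :: "real^2^2"
    using entries(1,2,4)[OF that] by (simp_all add: det_2 algebra_simps)
  have "B $ 1 $ 1 = C $ 1 $ 1" "B $ 2 $ 2 = C $ 2 $ 2" "B $ 1 $ 2 = C $ 1 $ 2"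
    using ch[OF B BA] ch[OF C CA] entries(3)[OF B BA] entries(3)[OF C CA] tpos d unfolding t
    by (metis less_irrefl mult_cancel_right)+
  then show ?thesis using entries(4)[OF B BA] entries(4)[OF C CA]
    by (simp add: vec_eq_iff forall_2)
qed

lemma spd_sqrt:
  assumes "pos_def A"
  shows "pos_def (spd_sqrt A)" "spd_sqrt A ** spd_sqrt A = A"
proof -
  have "\<exists>!B. pos_def B \<and> B ** B = A"
    using pos_def_sqrt_exists[OF assms] pos_def_sqrt_unique by blast
  from theI'[OF this] show "pos_def (spd_sqrt A)" "spd_sqrt A ** spd_sqrt A = A"
    by (simp_all add: spd_sqrt_def)
qed

text \<open>Cauchy-Schwarz on |N^T y|^2 = y . N N^T y. The congruence acts on vectors by the
  transpose of T, whereas \<open>f1\<close> is the norm of a conjugate of T itself.\<close>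

lemma norm_transpose_le_onorm:
  fixes N :: "real^'n^'n"
  shows "norm (transpose N *v y) \<le> onorm (\<lambda>z. N *v z) * norm y"
proof -
  let ?w = "transpose N *v y"
  have "(norm ?w)\<^sup>2 = y \<bullet> (N *v ?w)"
    by (metis dot_lmul_matrix power2_norm_eq_inner transpose_matrix_vector)
  also have "\<dots> \<le> norm y * norm (N *v ?w)" by (rule norm_cauchy_schwarz)
  also have "\<dots> \<le> norm y * (onorm (\<lambda>z. N *v z) * norm ?w)"
    by (intro mult_left_mono onorm matrix_vector_mul_bounded_linear) simp
  finally have "norm ?w * norm ?w \<le> norm ?w * (onorm (\<lambda>z. N *v z) * norm y)"
    by (simp add: power2_eq_square mult_ac)
  \<comment> \<open>Covers the case of a zero left-hand side, where the common factor cannot be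
    cancelled.\<close>
  moreover have "0 \<le> onorm (\<lambda>z. N *v z) * norm y"
    by (simp add: onorm_pos_le matrix_vector_mul_bounded_linear)
  ultimately show ?thesis
    by (metis mult_le_cancel_left_pos norm_ge_zero order_le_less)
qed

text \<open>Let R be the root of the pressure and N = R^-1 T R. Then N^T R = R T^T, so |R T^T z| =
  |N^T R z| is at most |N| |R z|, and |R z|^2 is the pressure form.\<close>

lemma quad_form_transform_le:
  assumes pd: "pos_def (pressure U)"
  shows "quad_form (pressure U) (T $ 1 $ 1 * a + T $ 2 $ 1 * b) (T $ 1 $ 2 * a + T $ 2 $ 2 * b)
     \<le> f1 T U * quad_form (pressure U) a b"
proof -
  define P where "P = pressure U"
  define R where "R = spd_sqrt P"
  define N where "N = matrix_inv R ** T ** R"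
  have R: "pos_def R" "R ** R = P" using spd_sqrt pd by (auto simp: R_def P_def)
  have tR: "transpose R = R" using R by (simp add: pos_def_def)
  have "invertible R" using pos_def_det_pos[OF R(1)] by (simp add: invertible_det_nz)
  then have inv: "R ** matrix_inv R = mat 1"
    unfolding invertible_def matrix_inv_def by (rule someI2_ex) blast
  have form: "(norm (R *v z))\<^sup>2 = quad_form P (z $ 1) (z $ 2)" for z
  proof -
    have "(norm (R *v z))\<^sup>2 = z \<bullet> (R *v (R *v z))"
      by (metis dot_lmul_matrix power2_norm_eq_inner tR transpose_matrix_vector)
    then show ?thesis
      using pd by (simp add: matrix_vector_mul_assoc R quad_form_eq_inner pos_def_iff P_def)
  qed
  let ?z = "vector [a, b] :: real^2"
  have "transpose N ** R = R ** transpose T"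
  proof -
    have "R ** N = T ** R" by (simp add: N_def matrix_mul_assoc inv)
    then have "transpose (R ** N) = transpose (T ** R)" by simp
    then show ?thesis by (simp add: matrix_transpose_mul tR)
  qed
  then have "R *v (transpose T *v ?z) = transpose N *v (R *v ?z)"
    by (simp add: matrix_vector_mul_assoc del: transpose_matrix_vector)
  then have "(norm (R *v (transpose T *v ?z)))\<^sup>2 \<le> (onorm (\<lambda>z. N *v z) * norm (R *v ?z))\<^sup>2"
    by (simp add: norm_transpose_le_onorm power_mono del: transpose_matrix_vector)
  also have "\<dots> = f1 T U * (norm (R *v ?z))\<^sup>2"
    by (simp add: f1_def power_mult_distrib N_def R_def P_def)
  finally show ?thesis
    unfolding form P_def[symmetric]
    by (simp add: matrix_vector_mult_def sum_2 transpose_def del: transpose_matrix_vector)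
qed

text \<open>The transpose of T fixes the vector (0, 1), which is tested in
  \<open>quad_form_transform_le\<close>.\<close>

lemma one_le_f1:
  assumes pd: "pos_def (pressure U)" and "T $ 2 $ 1 = 0" "T $ 2 $ 2 = 1"
  shows "1 \<le> f1 T U"
proof -
  have "quad_form (pressure U) 0 1 \<le> f1 T U * quad_form (pressure U) 0 1"
    using quad_form_transform_le[OF pd, of T 0 1] assms by simp
  moreover have "0 < quad_form (pressure U) 0 1" using pd by (simp add: pos_def_iff)
  ultimately show ?thesis by simp
qed

text \<open>The value is the nonnegative root of x^2 + (f + g - 1) x - g. The last claim says that
  this quadratic is nonnegative beyond the root; it is stated for all larger \<theta> because
  \<open>theta_star\<close> is a maximum.\<close>

lemma theta_root_bounds:
  assumes "1 \<le> f" "0 \<le> g"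
  shows "0 \<le> theta_root f g" "theta_root f g < 1" "g > 0 \<Longrightarrow> 0 < theta_root f g"
    and "\<And>\<theta>. theta_root f g \<le> \<theta> \<Longrightarrow> (1 - \<theta>) * g \<le> \<theta> * (f - 1 + \<theta>)"
proof -
  let ?e = "f + g - 1"
  let ?S = "sqrt (?e\<^sup>2 + 4 * g)"
  have root: "theta_root f g = (?S - ?e) / 2" by (simp add: theta_root_def)
  have S2: "?S\<^sup>2 = ?e\<^sup>2 + 4 * g" using assms by simp
  have "sqrt (?e\<^sup>2) \<le> ?S" using assms by (intro real_sqrt_le_mono) simp
  then have e: "?e \<le> ?S" using assms by simp
  then show "0 \<le> theta_root f g" by (simp add: root)
  have "sqrt (?e\<^sup>2) < ?S" if "g > 0" using that by (intro real_sqrt_less_mono) simp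
  then show "g > 0 \<Longrightarrow> 0 < theta_root f g" using assms by (simp add: root)
  \<comment> \<open>The two sides differ by 4 f.\<close>
  have "?e\<^sup>2 + 4 * g < (?e + 2)\<^sup>2" using assms by (simp add: power2_eq_square algebra_simps)
  then have "?S < sqrt ((?e + 2)\<^sup>2)" by (rule real_sqrt_less_mono)
  then show "theta_root f g < 1" using assms by (simp add: root)
  fix \<theta> assume "theta_root f g \<le> \<theta>"
  then have "?S \<le> 2 * \<theta> + ?e" by (simp add: root)
  then have "?S\<^sup>2 \<le> (2 * \<theta> + ?e)\<^sup>2" using assms by (intro power_mono) auto
  then show "(1 - \<theta>) * g \<le> \<theta> * (f - 1 + \<theta>)"
    unfolding S2 by (simp add: power2_eq_square algebra_simps)
qed

text \<open>Young's inequality \<open>\<xi> (X + d)\<^sup>2 \<le> X\<^sup>2 + \<xi> / (1 - \<xi>) d\<^sup>2\<close> reduces the claim to the quadratic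
  inequality that characterises \<open>\<theta>\<close>.\<close>

lemma shifted_square_le:
  fixes X d y f g \<theta> \<xi> :: real
  assumes f: "1 \<le> f" and g: "0 \<le> g" and \<theta>: "theta_root f g \<le> \<theta>" "\<theta> < 1"
    and \<xi>: "\<xi> = (1 - \<theta>) / f" and d: "d\<^sup>2 \<le> g * y" and y: "0 \<le> y"
  shows "\<xi> * ((X + d)\<^sup>2 + f * y) \<le> X\<^sup>2 + y"
proof -
  note \<theta>b = theta_root_bounds[OF f g]
  have \<xi>f: "\<xi> * f = 1 - \<theta>" using f by (simp add: \<xi>)
  have \<xi>0: "0 \<le> \<xi>" using \<xi> \<theta> f by simp
  have "1 - \<theta> \<le> 1" using \<theta> \<theta>b(1) by linarith
  show ?thesis
  \<comment> \<open>For g = 0 the shift d vanishes and \<xi> may equal 1, where Young's inequality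
    has no meaning.\<close>
  proof (cases "g = 0")
    case True
    then have "d = 0" using d by simp
    have "\<xi> \<le> 1" using \<xi> \<open>1 - \<theta> \<le> 1\<close> f by simp
    have "\<xi> * ((X + d)\<^sup>2 + f * y) = \<xi> * X\<^sup>2 + (1 - \<theta>) * y"
      using \<xi>f \<open>d = 0\<close> by (simp add: distrib_left mult.assoc[symmetric])
    also have "\<dots> \<le> 1 * X\<^sup>2 + 1 * y"
      using \<open>\<xi> \<le> 1\<close> \<open>1 - \<theta> \<le> 1\<close> y by (intro add_mono mult_right_mono) auto
    finally show ?thesis by simp
  next
    case False
    then have "0 < \<theta>" using \<theta>b(3) g \<theta> by fastforce
    then have \<xi>1: "\<xi> < 1" using \<xi> f by simp
    have key: "\<xi> * g \<le> \<theta> * (1 - \<xi>)"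
    proof -
      have "f * (\<xi> * g) = (1 - \<theta>) * g" using \<xi>f by (simp add: mult_ac)
      also have "\<dots> \<le> \<theta> * (f - 1 + \<theta>)" by (rule \<theta>b(4)[OF \<theta>(1)])
      also have "\<dots> = \<theta> * (f - \<xi> * f)" using \<xi>f by simp
      also have "\<dots> = f * (\<theta> * (1 - \<xi>))" by (simp add: algebra_simps)
      finally show ?thesis using f by simp
    qed
    \<comment> \<open>Young's inequality multiplied by 1 - \<xi>; this square is its defect.\<close>
    have "0 \<le> ((1 - \<xi>) * X - \<xi> * d)\<^sup>2" by simp
    then have "(1 - \<xi>) * (\<xi> * (X + d)\<^sup>2) \<le> (1 - \<xi>) * X\<^sup>2 + \<xi> * d\<^sup>2"
      by (simp add: power2_eq_square algebra_simps)
    also have "\<xi> * d\<^sup>2 \<le> \<xi> * (g * y)" using d \<xi>0 by (rule mult_left_mono)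
    also have "\<xi> * (g * y) \<le> \<theta> * (1 - \<xi>) * y"
      using mult_right_mono[OF key y] by (simp add: mult.assoc)
    finally have "(1 - \<xi>) * (\<xi> * (X + d)\<^sup>2) \<le> (1 - \<xi>) * (X\<^sup>2 + \<theta> * y)"
      by (simp add: algebra_simps)
    then have "\<xi> * (X + d)\<^sup>2 \<le> X\<^sup>2 + \<theta> * y" using \<xi>1 by simp
    moreover have "\<xi> * (f * y) = (1 - \<theta>) * y" using \<xi>f by (simp add: mult.assoc[symmetric])
    ultimately show ?thesis by (simp add: algebra_simps)
  qed
qed

text \<open>Multiplied by \<rho>, the form of the transformed state is a shifted square (X + e)^2
  plus a transformed pressure form. With y as \<rho> times the pressure form, e^2 is at most f3 y
  and the second part at most f1 y, so \<open>shifted_square_le\<close> applies.\<close>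

lemma
  assumes U: "U \<in> admissible" and T: "T $ 2 $ 1 = 0" "T $ 2 $ 2 = 1"
  shows xi_star_pos: "0 < xi_star T U"
    and nonneg_state_diff_transform: "nonneg_state (U - xi_star T U *\<^sub>R transform T U)"
proof -
  have \<rho>: "U $ 1 > 0" and pd: "pos_def (pressure U)"
    using U by (auto simp: admissible_def dens_def)
  note p22 = pos_def_diag_pos(2)[OF pd] and d = pos_def_det_pos[OF pd]
  have f1: "1 \<le> f1 T U" by (rule one_le_f1[OF pd T])
  have g2: "0 \<le> f2 T U" using \<rho> pos_def_diag_pos[OF pd] by (simp add: f2_def q_defect_def dens_def)
  have g3: "0 \<le> f3 T U" using \<rho> p22 d by (simp add: f3_def q_defect_def dens_def)
  have \<theta>1: "theta_star T U < 1" 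
    using theta_root_bounds(2)[OF f1 g2] theta_root_bounds(2)[OF f1 g3] by (simp add: theta_star_def)
  show pos: "0 < xi_star T U" using \<theta>1 f1 by (simp add: xi_star_def)
  show "nonneg_state (U - xi_star T U *\<^sub>R transform T U)"
    unfolding nonneg_state_def
  proof (intro allI)
    fix s a b :: real
    define X where "X = U $ 1 * s + U $ 2 * a + U $ 3 * b"
    \<comment> \<open>The change of X when (a, b) is replaced by its image under the transpose of T;
      its square is \<open>q_defect\<close> times a^2.\<close>
    define e where "e = (U $ 2 * (T $ 1 $ 1 - 1) + U $ 3 * T $ 1 $ 2) * a"
    define y where "y = U $ 1 * quad_form (pressure U) a b"
    have quad: "a\<^sup>2 * det (pressure U) \<le> pressure U $ 2 $ 2 * quad_form (pressure U) a b"
      using pd by (intro det_le_quad_form) (simp add: pos_def_iff)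
    have "0 \<le> quad_form (pressure U) a b"
      using pd by (cases "a \<noteq> 0 \<or> b \<noteq> 0") (auto simp: pos_def_iff less_imp_le quad_form_def)
    then have y: "0 \<le> y" using \<rho> by (simp add: y_def)
    have "e\<^sup>2 = q_defect T U * a\<^sup>2"
      by (simp add: e_def q_defect_def mom_def power2_eq_square algebra_simps)
    also have "\<dots> \<le> q_defect T U * (pressure U $ 2 $ 2 * quad_form (pressure U) a b / det (pressure U))"
      using quad d by (intro mult_left_mono) (auto simp: q_defect_def field_simps)
    also have "\<dots> = f3 T U * y"
      using \<rho> by (simp add: f3_def y_def dens_def)
    finally have e: "e\<^sup>2 \<le> f3 T U * y" .
    have le: "xi_star T U * ((X + e)\<^sup>2 + f1 T U * y) \<le> X\<^sup>2 + y"
      using shifted_square_le[OF f1 g3 _ \<theta>1 xi_star_def e y] by (simp add: theta_star_def)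
    have "U $ 1 * quad_form (pressure U) (T $ 1 $ 1 * a) (T $ 1 $ 2 * a + b) \<le> f1 T U * y"
      using mult_left_mono[OF quad_form_transform_le[OF pd, of T a b], of "U $ 1"] \<rho> T
      by (simp add: y_def mult_ac)
    then have "U $ 1 * state_form (transform T U) s a b \<le> (X + e)\<^sup>2 + f1 T U * y"
      using \<rho> T by (simp add: state_form_transform state_form_complete_square X_def e_def algebra_simps)
    then have "xi_star T U * (U $ 1 * state_form (transform T U) s a b) \<le> X\<^sup>2 + y"
      using le pos by (meson less_imp_le mult_left_mono order_trans)
    also have "\<dots> = U $ 1 * state_form U s a b"
      using \<rho> by (simp add: state_form_complete_square X_def y_def)
    finally have "U $ 1 * (xi_star T U * state_form (transform T U) s a b) \<le> U $ 1 * state_form U s a b"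
      by (simp add: mult_ac)
    then have "xi_star T U * state_form (transform T U) s a b \<le> state_form U s a b"
      using \<rho> by simp
    then show "0 \<le> state_form (U - xi_star T U *\<^sub>R transform T U) s a b"
      using state_form_add[of U "(- xi_star T U) *\<^sub>R transform T U" s a b]
      by (simp add: state_form_scaleR del: scaleR_minus_left) simp
  qed
qed

section \<open>Quadrature\<close>

text \<open>Only node i contributes to the sum for P, so w i times a positive value equals the mean
  of a nonnegative function.\<close>

lemma exact_mean_rule_weight_nonneg:
  assumes rule: "exact_mean_rule a b n x w d" and ab: "a < b" and i: "i \<in> {1..n}"
    and deg: "degree P \<le> d" and P: "\<And>y. y \<in> {a..b} \<Longrightarrow> 0 \<le> poly P y"
    and zero: "\<And>m. m \<in> {1..n} \<Longrightarrow> m \<noteq> i \<Longrightarrow> poly P (x m) = 0"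
    and pos: "0 < poly P (x i)"
  shows "0 \<le> w i"
proof -
  have "(\<Sum>m=1..n. w m * poly P (x m)) = (\<Sum>m=1..n. if m = i then w i * poly P (x i) else 0)"
    by (intro sum.cong) (auto simp: zero)
  also have "\<dots> = w i * poly P (x i)" using i by simp
  finally have "w i * poly P (x i) = integral {a..b} (poly P) / (b - a)"
    using rule deg by (simp add: exact_mean_rule_def)
  moreover have "0 \<le> integral {a..b} (poly P)"
    by (intro integral_nonneg integrable_continuous_real continuous_on_poly continuous_on_id) (rule P)
  ultimately have "0 \<le> w i * poly P (x i)" using ab by simp
  then show ?thesis using pos by (simp add: zero_le_mult_iff)
qed

definition nodal_poly :: "nat set \<Rightarrow> (nat \<Rightarrow> real) \<Rightarrow> real poly" where
  "nodal_poly A x = (\<Prod>m\<in>A. [:- x m, 1:])"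

lemma degree_nodal_poly: "degree (nodal_poly A x) = card A"
  unfolding nodal_poly_def by (subst degree_prod_eq_sum_degree) auto

lemma poly_nodal_poly: "poly (nodal_poly A x) y = (\<Prod>m\<in>A. y - x m)"
  by (simp add: nodal_poly_def poly_prod)

text \<open>Test polynomial: the squared nodal polynomial of the other n - 1 nodes, of degree 2 n -
  2.\<close>

lemma gauss_weight_nonneg:
  assumes rule: "gauss_rule a b n x w" and ab: "a < b" and i: "i \<in> {1..n}"
  shows "0 \<le> w i"
proof -
  have inj: "inj_on x {1..n}" and ex: "exact_mean_rule a b n x w (2 * n - 1)"
    using rule by (auto simp: gauss_rule_def dest: strict_mono_on_imp_inj_on)
  let ?P = "(nodal_poly ({1..n} - {i}) x)\<^sup>2"
  have deg: "degree ?P \<le> 2 * n - 1"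
    using i by (intro order.trans[OF degree_power_le]) (simp add: degree_nodal_poly)
  have "x i \<noteq> x m" if "m \<in> {1..n} - {i}" for m
    using inj_onD[OF inj, of i m] i that by auto
  then have "0 < poly ?P (x i)" by (simp add: poly_nodal_poly zero_less_power2)
  then show ?thesis
    by (intro exact_mean_rule_weight_nonneg[OF ex ab i deg]) (auto simp: poly_nodal_poly)
qed

lemma lobatto_weight_nonneg:
  assumes rule: "lobatto_rule a b n x w" and ab: "a < b" and i: "i \<in> {1..n}"
  shows "0 \<le> w i"
proof (cases "i = 1 \<or> i = n")
  case True
  then show ?thesis using rule by (auto simp: lobatto_rule_def)
next
  case False
  then have i': "1 < i" "i < n" using i by auto
  have mono: "strict_mono_on {1..n} x" and ends: "x 1 = a" "x n = b"
    and ex: "exact_mean_rule a b n x w (2 * n - 3)"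
    using rule by (auto simp: lobatto_rule_def)
  have inj: "inj_on x {1..n}" using mono by (rule strict_mono_on_imp_inj_on)
  let ?A = "{2..n-1} - {i}"
  \<comment> \<open>The factor (y - a)(b - y) vanishes at both ends and is nonnegative between them;
    squaring the other n - 3 interior factors gives total degree at most 2 n - 4.\<close>
  let ?P = "[:- a, 1:] * [:b, -1:] * (nodal_poly ?A x)\<^sup>2"
  have card: "card ?A = n - 3" using i' by simp
  have "degree ?P \<le> degree ([:- a, 1:] * [:b, -1:]) + degree ((nodal_poly ?A x)\<^sup>2)"
    by (rule degree_mult_le)
  also have "\<dots> \<le> 2 + 2 * (n - 3)"
    using degree_power_le[of "nodal_poly ?A x" 2] unfolding degree_nodal_poly card by simp
  finally have deg: "degree ?P \<le> 2 * n - 3" using i' by simp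
  have Pval: "poly ?P y = (y - a) * (b - y) * (\<Prod>m\<in>?A. y - x m)\<^sup>2" for y
    by (simp add: poly_nodal_poly algebra_simps)
  have "x i \<noteq> x m" if "m \<in> ?A" for m
    using inj_onD[OF inj, of i m] i' that by fastforce
  moreover have "a < x i" "x i < b"
    using strict_mono_onD[OF mono, of 1 i] strict_mono_onD[OF mono, of i n] i' ends by auto
  ultimately have pos: "0 < poly ?P (x i)" unfolding Pval by (simp add: zero_less_power2)
  have zero: "poly ?P (x m) = 0" if "m \<in> {1..n}" "m \<noteq> i" for m
  proof -
    have "m = 1 \<or> m = n \<or> m \<in> ?A" using that by auto
    then show ?thesis unfolding Pval using ends by auto
  qed
  have nonneg: "0 \<le> poly ?P y" if "y \<in> {a..b}" for y
    unfolding Pval using that by (intro mult_nonneg_nonneg) auto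
  show ?thesis
    by (rule exact_mean_rule_weight_nonneg[OF ex ab i deg nonneg zero pos])
qed

section \<open>Cell averages\<close>

lemma U_avg_eq_quadrature:
  assumes rule: "exact_mean_rule (iface D (j - 1)) (iface D j) n x w d"
    and deg: "\<And>i. degree (U_h D j $ i) \<le> d"
  shows "U_avg D j = (\<Sum>\<nu>=1..n. w \<nu> *\<^sub>R U_val D j (x \<nu>))"
proof -
  have cont: "continuous_on S (U_val D j)" for S
    unfolding U_val_def by (intro continuous_intros continuous_on_vec_lambda)
  have comp: "(\<lambda>y. U_val D j y $ i) = poly (U_h D j $ i)" for i
    by (simp add: U_val_def fun_eq_iff)
  have "integral {iface D (j - 1)..iface D j} (U_val D j) $ i
      = integral {iface D (j - 1)..iface D j} (poly (U_h D j $ i))" for i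
    using integral_component_eq_cart[OF integrable_continuous_real[OF cont], of "iface D (j - 1)" "iface D j" i]
    by (simp add: comp)
  then show ?thesis
    using rule deg
    by (simp add: vec_eq_iff U_avg_def cell_avg_def exact_mean_rule_def cell_len_def)
       (simp add: U_val_def)
qed

lemma exact_mean_rule_pderiv:
  assumes rule: "exact_mean_rule a b n x w d" and ab: "a < b" and deg: "degree P \<le> d"
  shows "(\<Sum>\<mu>=1..n. w \<mu> * poly (pderiv P) (x \<mu>)) = (poly P b - poly P a) / (b - a)"
proof -
  have "(poly (pderiv P) has_integral (poly P b - poly P a)) {a..b}"
    using ab
    by (intro fundamental_theorem_of_calculus)
       (auto simp: has_real_derivative_iff_has_vector_derivative[symmetric]
         intro: has_field_derivative_at_within poly_DERIV)
  moreover have "degree (pderiv P) \<le> d" using deg by (simp add: degree_pderiv)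
  ultimately show ?thesis using rule by (simp add: exact_mean_rule_def integral_unique)
qed

text \<open>The Gauss rule integrates the derivative of p11 exactly, so the subtracted sum becomes a
  difference of inner traces, which merges with the difference of \<open>p11_star\<close> into
  \<open>alpha11\<close>.\<close>

lemma source_avg_eq:
  assumes rule: "exact_mean_rule (iface D (j - 1)) (iface D j) (gauss_num D) (gauss_pt D j) (gauss_wt D) d"
    and deg: "degree (p11_e D j) \<le> d" and len: "iface D (j - 1) < iface D j"
  shows "source_avg D j
    = (\<Sum>\<mu>=1..gauss_num D. gauss_wt D \<mu> *\<^sub>R
        ((poly (pderiv (p11_e D j)) (gauss_pt D j \<mu>) / poly (rho_e D j) (gauss_pt D j \<mu>))
           *\<^sub>R S1 (U_val D j (gauss_pt D j \<mu>))))
      + alpha11 D j *\<^sub>R S1 (U_avg D j)"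
proof -
  let ?p = "\<lambda>\<mu>. poly (pderiv (p11_e D j)) (gauss_pt D j \<mu>)"
  let ?w = "gauss_wt D" and ?V = "S1 (U_avg D j)" and ?r = "rho_e_avg D j" and ?N = "gauss_num D"
  let ?d = "p11_star D j - p11_star D (j - 1)"
  have quad: "(\<Sum>\<mu>=1..?N. ?w \<mu> * ?p \<mu>)
      = (poly (p11_e D j) (iface D j) - poly (p11_e D j) (iface D (j - 1))) / cell_len D j"
    using exact_mean_rule_pderiv[OF rule len deg] by (simp add: cell_len_def)
  have "(\<Sum>\<mu>=1..?N. (?w \<mu> * ?p \<mu>) *\<^sub>R ((1 / ?r) *\<^sub>R ?V)) = ((\<Sum>\<mu>=1..?N. ?w \<mu> * ?p \<mu>) / ?r) *\<^sub>R ?V"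
    by (simp add: scaleR_left.sum[symmetric] flip: sum_divide_distrib)
  moreover have "alpha11 D j = ?d / (cell_len D j * ?r) - (\<Sum>\<mu>=1..?N. ?w \<mu> * ?p \<mu>) / ?r"
    unfolding quad alpha11_def by (simp add: diff_divide_distrib add_divide_distrib)
  ultimately show ?thesis
    by (simp add: source_avg_def scaleR_right_diff_distrib sum_subtractf scaleR_left_diff_distrib)
qed

lemma sum_atLeastAtMost_ends:
  fixes f :: "nat \<Rightarrow> 'a::comm_monoid_add"
  assumes "2 \<le> n"
  shows "(\<Sum>i=1..n. f i) = f 1 + f n + (\<Sum>i\<in>{2..n-1}. f i)"
proof -
  have "{1..n} = insert 1 (insert n {2..n-1})" using assms by auto
  then show ?thesis using assms by (simp add: add.assoc)
qed

section \<open>Interface matrices\<close>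

lemma T_side_nth:
  "T_side D j c $ 2 $ 1 = 0" "T_side D j c $ 2 $ 2 = 1"
  by (simp_all add: T_side_def Let_def)

text \<open>The maximum \<open>p11_star\<close> dominates the trace on either side and p22 is
  positive, so the modified determinant is at least the original one, which is positive.\<close>

lemma T_side_nonzero:
  assumes c: "c = j \<or> c = j + 1" and pd: "pos_def (p_e D c (iface D j))"
  shows "T_side D j c $ 1 $ 1 \<noteq> 0"
proof -
  have "poly (p22_e D c) (iface D j) > 0" using pos_def_diag_pos(2)[OF pd] by (simp add: p_e_def)
  moreover have "poly (p11_e D c) (iface D j) \<le> p11_star D j" using c by (auto simp: p11_star_def)
  ultimately have "det (p_e D c (iface D j)) \<le> det (p_e_star D j c)"
    by (simp add: det_2 p_e_def p_e_star_def mult_right_mono)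
  then show ?thesis using pos_def_det_pos[OF pd] by (simp add: T_side_def Let_def)
qed

lemma pos_def_p_e:
  assumes "\<And>z::real^2. z \<noteq> 0 \<Longrightarrow> z \<bullet> (p_e D c x *v z) > 0"
  shows "pos_def (p_e D c x)"
  using assms by (auto simp: pos_def_def vec_eq_iff transpose_def forall_2 p_e_def)

lemma transform_T_side_admissible:
  assumes "c = j \<or> c = j + 1" "pos_def (p_e D c (iface D j))" "U \<in> admissible"
  shows "transform (T_side D j c) U \<in> admissible"
  using assms T_side_nonzero by (intro transform_admissible T_side_nth) auto

text \<open>The flux property is used with \<lambda> = \<tau> / (c \<omega> \<xi>), for which
  \<open>le\<close> is the required bound 1/2, and is then rescaled. Positivity of c follows from
  that of \<open>alpha1\<close>.\<close>

lemma flux_difference_admissible: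
  assumes F: "positivity_preserving_flux F"
    and UL: "UL \<in> admissible" and UM: "UM \<in> admissible" and UR: "UR \<in> admissible"
    and \<tau>: "0 < \<tau>" and \<xi>: "0 < \<xi>" and \<omega>: "0 < \<omega>"
    and A: "{UL, UM, UR} = A"
    and le: "\<tau> * (2 / \<xi> * Max (alpha1 ` A)) / \<omega> \<le> c"
  shows "0 < c" "(c * \<omega> * \<xi>) *\<^sub>R UM - \<tau> *\<^sub>R (F UM UR - F UL UM) \<in> admissible"
proof -
  have fin: "finite A" using A by auto
  have "alpha1 UM \<le> Max (alpha1 ` A)" using fin A by (intro Max_ge) auto
  then have "0 < Max (alpha1 ` A)" using alpha1_pos[OF UM] by linarith
  then have "0 < \<tau> * (2 / \<xi> * Max (alpha1 ` A)) / \<omega>" using \<tau> \<xi> \<omega> by simp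
  then show c: "0 < c" using le by linarith
  let ?l = "\<tau> / (c * \<omega> * \<xi>)"
  have l: "0 < ?l" using c \<tau> \<xi> \<omega> by simp
  have "?l * Max (alpha1 ` {UL, UM, UR}) \<le> 1 / 2"
    using le c \<xi> \<omega> unfolding A by (simp add: field_simps)
  then have "UM - ?l *\<^sub>R (F UM UR - F UL UM) \<in> admissible"
    using F UL UM UR l unfolding positivity_preserving_flux_def by blast
  then have "(c * \<omega> * \<xi>) *\<^sub>R (UM - ?l *\<^sub>R (F UM UR - F UL UM)) \<in> admissible"
    using c \<omega> \<xi> by (intro admissible_scaleR) auto
  then show "(c * \<omega> * \<xi>) *\<^sub>R UM - \<tau> *\<^sub>R (F UM UR - F UL UM) \<in> admissible"
    using c \<omega> \<xi> by (simp add: scaleR_right_diff_distrib)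
qed

section \<open>Positivity of the updated averages\<close>

theorem theorem3p10:
  fixes D :: dg_data and k :: nat and n :: int and dt :: real
  assumes k: "k \<ge> 1"
    and flux: "positivity_preserving_flux (flux D)"
    (* physical cells 1..n, ghost cells 0 and n+1 *)
    and mesh: "\<forall>j\<in>{0..n+1}. iface D (j - 1) < iface D j"
    and degrees: "\<forall>j\<in>{0..n+1}. degree (rho_e D j) \<le> k \<and> degree (p11_e D j) \<le> k
                    \<and> degree (p22_e D j) \<le> k \<and> (\<forall>i. degree (U_h D j $ i) \<le> k)"
    and gauss_exact: "k \<le> 2 * gauss_num D - 1"
    and gauss: "\<forall>j\<in>{0..n+1}.
          gauss_rule (iface D (j - 1)) (iface D j) (gauss_num D) (gauss_pt D j) (gauss_wt D)"
    and lobatto: "\<forall>j\<in>{0..n+1}.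
          lobatto_rule (iface D (j - 1)) (iface D j) (lobatto_num k) (lob_pt D j) (lob_wt D)"
    and equilibrium: "\<forall>j\<in>{0..n+1}. \<forall>x\<in>nodes D k j.
          poly (rho_e D j) x > 0 \<and> (\<forall>z::real^2. z \<noteq> 0 \<longrightarrow> z \<bullet> (p_e D j x *v z) > 0)"
    and solution: "\<forall>j\<in>{0..n+1}. \<forall>x\<in>nodes D k j. U_val D j x \<in> admissible"
    and dt: "dt > 0"
    and CFL: "\<forall>j\<in>{1..n}.
          dt * (max (eta_minus D j) (eta_plus D j) / (lob_wt D 1 * cell_len D j) + beta11 D j) \<le> 1"
  shows "\<forall>j\<in>{1..n}. U_new D dt j \<in> admissible"
proof
  fix j assume j: "j \<in> {1..n}"
  define L where "L = lobatto_num k"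
  define h where "h = cell_len D j"
  define w where "w = lob_wt D"
  define \<tau> where "\<tau> = dt / h"
  define \<beta> where "\<beta> = Max ((\<lambda>\<mu>. \<bar>poly (pderiv (p11_e D j)) (gauss_pt D j \<mu>) / poly (rho_e D j) (gauss_pt D j \<mu>)
               * delta1 (U_val D j (gauss_pt D j \<mu>))\<bar>) ` {1..gauss_num D})"
  define \<beta>' where "\<beta>' = \<bar>alpha11 D j * delta1 (U_avg D j)\<bar>"
  \<comment> \<open>The fraction of the average left for the fluxes after the source has taken dt *
    \<open>beta11\<close>.\<close>
  define c where "c = 1 - dt * beta11 D j"
  define Um where "Um = U_minus D j"
  define Up where "Up = U_plus D (j - 1)"
  define \<xi>m where "\<xi>m = xi_star (T_minus D j) Um"
  define \<xi>p where "\<xi>p = xi_star (T_plus D (j - 1)) Up"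
  define I where "I = (\<Sum>\<nu>\<in>{2..L-1}. w \<nu> *\<^sub>R U_val D j (lob_pt D j \<nu>))"
  define src where "src \<mu> = (poly (pderiv (p11_e D j)) (gauss_pt D j \<mu>) / poly (rho_e D j) (gauss_pt D j \<mu>))
      *\<^sub>R S1 (U_val D j (gauss_pt D j \<mu>))" for \<mu>

  \<comment> \<open>Mesh, quadrature rules and admissibility of the traces\<close>
  have \<beta>_sum: "beta11 D j = \<beta> + \<beta>'" by (simp add: beta11_def \<beta>_def \<beta>'_def)
  have cells: "j - 1 \<in> {0..n+1}" "j \<in> {0..n+1}" "j + 1 \<in> {0..n+1}" using j by auto
  have len: "iface D (j - 1) < iface D j" using mesh cells by blast
  then have h: "h > 0" by (simp add: h_def cell_len_def)
  then have \<tau>: "\<tau> > 0" using dt by (simp add: \<tau>_def)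
  \<comment> \<open>Rounding up gives 2 L at least k + 3, so exactness degree 2 L - 3 covers degree
    k.\<close>
  have "(real k + 3) / 2 \<le> real L" by (simp add: L_def lobatto_num_def real_nat_ceiling_ge)
  then have "real (k + 3) \<le> real (2 * L)" by simp
  then have "k + 3 \<le> 2 * L" by (simp only: of_nat_le_iff)
  then have L: "2 \<le> L" "k \<le> 2 * L - 3" using k by auto
  have lob: "lobatto_rule (iface D (i - 1)) (iface D i) L (lob_pt D i) w" if "i \<in> {0..n+1}" for i
    using lobatto that by (simp add: L_def w_def)
  have w1: "w 1 > 0" and wL: "w L = w 1" and wnn: "\<And>\<nu>. \<nu> \<in> {1..L} \<Longrightarrow> 0 \<le> w \<nu>"
    using lob[OF cells(2)] L(1) lobatto_weight_nonneg[OF lob[OF cells(2)] len]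
    by (auto simp: lobatto_rule_def)
  have lob_ends: "lob_pt D i 1 = iface D (i - 1)" "lob_pt D i L = iface D i" if "i \<in> {0..n+1}" for i
    using lob[OF that] by (auto simp: lobatto_rule_def)
  have ends: "iface D i \<in> nodes D k i" "iface D (i - 1) \<in> nodes D k i" if "i \<in> {0..n+1}" for i
    unfolding lob_ends[OF that, symmetric] using L(1) by (auto simp: nodes_def L_def)
  have pd: "pos_def (p_e D i x)" if "i \<in> {0..n+1}" "x \<in> nodes D k i" for i x
    using equilibrium that by (intro pos_def_p_e) blast
  have hat_m: "Uhat_minus D i \<in> admissible" if "i \<in> {0..n+1}" for i
    unfolding Uhat_minus_def T_minus_def U_minus_def
    using that ends[OF that] pd solution by (intro transform_T_side_admissible) auto
  \<comment> \<open>Indexed by the cell containing the trace: cell i has its plus trace at interface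
    i - 1.\<close>
  have hat_p: "Uhat_plus D (i - 1) \<in> admissible" if "i \<in> {0..n+1}" for i
    unfolding Uhat_plus_def T_plus_def U_plus_def
    using that ends[OF that] pd solution by (intro transform_T_side_admissible) auto
  have hats: "Uhat_minus D (j - 1) \<in> admissible" "Uhat_minus D j \<in> admissible"
      "Uhat_plus D (j - 1) \<in> admissible" "Uhat_plus D j \<in> admissible"
    using hat_m[OF cells(1)] hat_m[OF cells(2)] hat_p[OF cells(2)] hat_p[OF cells(3)] by simp_all
  have adm: "Um \<in> admissible" "Up \<in> admissible"
    using ends[OF cells(2)] solution cells(2) by (auto simp: Um_def Up_def U_minus_def U_plus_def)
  have \<xi>m: "0 < \<xi>m" "nonneg_state (Um - \<xi>m *\<^sub>R Uhat_minus D j)"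
    unfolding \<xi>m_def Uhat_minus_def T_minus_def Um_def[symmetric]
    by (intro xi_star_pos nonneg_state_diff_transform adm T_side_nth)+
  have \<xi>p: "0 < \<xi>p" "nonneg_state (Up - \<xi>p *\<^sub>R Uhat_plus D (j - 1))"
    unfolding \<xi>p_def Uhat_plus_def T_plus_def Up_def[symmetric]
    by (intro xi_star_pos nonneg_state_diff_transform adm T_side_nth)+

  \<comment> \<open>Flux contributions\<close>
  have cfl: "\<tau> * \<eta> / w 1 \<le> c" if "\<eta> \<le> max (eta_minus D j) (eta_plus D j)" for \<eta>
  proof -
    have "\<tau> * \<eta> / w 1 \<le> \<tau> * max (eta_minus D j) (eta_plus D j) / w 1"
      using that \<tau> w1 by (intro divide_right_mono mult_left_mono) auto
    also have "\<dots> \<le> c"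
      using CFL j by (simp add: \<tau>_def c_def h_def w_def algebra_simps)
    finally show ?thesis .
  qed
  \<comment> \<open>Three-point updates centred at the two modified inner traces of cell j. The
    artificial flux between these traces enters A and B with opposite signs, so A + B contains only
    the two interface fluxes.\<close>
  define A where "A = (c * w 1 * \<xi>m) *\<^sub>R Uhat_minus D j
    - \<tau> *\<^sub>R (Fhat D j - flux D (Uhat_plus D (j - 1)) (Uhat_minus D j))"
  define B where "B = (c * w 1 * \<xi>p) *\<^sub>R Uhat_plus D (j - 1)
    - \<tau> *\<^sub>R (flux D (Uhat_plus D (j - 1)) (Uhat_minus D j) - Fhat D (j - 1))"
  have c: "0 < c" and A: "A \<in> admissible"
    unfolding A_def Fhat_def
    using cfl[of "eta_minus D j"] flux_difference_admissible[OF flux hats(3,2,4) \<tau> \<xi>m(1) w1, of _ c]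
    by (auto simp: eta_minus_def \<xi>m_def Um_def insert_commute)
  have B: "B \<in> admissible"
    unfolding B_def Fhat_def
    using cfl[of "eta_plus D j"] flux_difference_admissible(2)[OF flux hats(1,3,2) \<tau> \<xi>p(1) w1, of _ c]
    by (auto simp: eta_plus_def \<xi>p_def Up_def insert_commute)

  \<comment> \<open>Lobatto splitting of the cell average\<close>
  have "degree (p11_e D j) \<le> k" "\<And>i. degree (U_h D j $ i) \<le> k"
    using degrees cells(2) by blast+
  then have deg: "degree (p11_e D j) \<le> d" "\<And>i. degree (U_h D j $ i) \<le> d" if "k \<le> d" for d
    using that order_trans by blast+
  have "U_avg D j = (\<Sum>\<nu>=1..L. w \<nu> *\<^sub>R U_val D j (lob_pt D j \<nu>))"
    using lob[OF cells(2)] deg(2)[OF L(2)]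
    by (intro U_avg_eq_quadrature[where d = "2 * L - 3"]) (auto simp: lobatto_rule_def)
  then have avg: "U_avg D j = w 1 *\<^sub>R Up + w 1 *\<^sub>R Um + I"
    using lob_ends[OF cells(2)] unfolding sum_atLeastAtMost_ends[OF L(1)]
    by (simp add: wL Up_def Um_def U_minus_def U_plus_def I_def)
  have I: "nonneg_state I"
    unfolding I_def using solution cells(2)
    by (intro nonneg_state_sum nonneg_state_scaleR nonneg_state_admissible wnn)
       (auto simp: nodes_def L_def)
  have avg_adm: "U_avg D j \<in> admissible"
    unfolding avg using w1 adm I nonneg_state_admissible[OF adm(1)]
    by (intro admissible_add admissible_scaleR nonneg_state_scaleR) auto

  \<comment> \<open>Source contributions\<close>
  have gr: "gauss_rule (iface D (j - 1)) (iface D j) (gauss_num D) (gauss_pt D j) (gauss_wt D)"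
    using gauss cells(2) by blast
  then have ge: "exact_mean_rule (iface D (j - 1)) (iface D j) (gauss_num D) (gauss_pt D j)
      (gauss_wt D) (2 * gauss_num D - 1)" by (simp add: gauss_rule_def)
  have gavg: "U_avg D j = (\<Sum>\<mu>=1..gauss_num D. gauss_wt D \<mu> *\<^sub>R U_val D j (gauss_pt D j \<mu>))"
    by (rule U_avg_eq_quadrature[OF ge deg(2)[OF gauss_exact]])
  have src: "source_avg D j = (\<Sum>\<mu>=1..gauss_num D. gauss_wt D \<mu> *\<^sub>R src \<mu>) + alpha11 D j *\<^sub>R S1 (U_avg D j)"
    unfolding src_def
    by (rule source_avg_eq[OF ge deg(1)[OF gauss_exact] len])
  \<comment> \<open>At each Gauss node \<beta> dominates the coefficient required by
    \<open>nonneg_state_source\<close>.\<close>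
  have "nonneg_state (\<Sum>\<mu>=1..gauss_num D. gauss_wt D \<mu> *\<^sub>R (\<beta> *\<^sub>R U_val D j (gauss_pt D j \<mu>) + src \<mu>))"
    unfolding src_def
    using solution cells(2)
    by (intro nonneg_state_sum nonneg_state_scaleR gauss_weight_nonneg[OF gr len] nonneg_state_source)
       (auto simp: nodes_def \<beta>_def intro!: Max_ge)
  then have src1: "nonneg_state (\<beta> *\<^sub>R U_avg D j + (\<Sum>\<mu>=1..gauss_num D. gauss_wt D \<mu> *\<^sub>R src \<mu>))"
    by (simp add: gavg scaleR_right_distrib sum.distrib scaleR_sum_right mult.commute)
  have src2: "nonneg_state (\<beta>' *\<^sub>R U_avg D j + alpha11 D j *\<^sub>R S1 (U_avg D j))"
    by (intro nonneg_state_source avg_adm) (simp add: \<beta>'_def)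

  \<comment> \<open>Assembly of the update\<close>
  have "U_avg D j = c *\<^sub>R (w 1 *\<^sub>R Up + w 1 *\<^sub>R Um + I) + dt *\<^sub>R (\<beta> *\<^sub>R U_avg D j) + dt *\<^sub>R (\<beta>' *\<^sub>R U_avg D j)"
    unfolding avg[symmetric] by (simp add: c_def \<beta>_sum algebra_simps)
  \<comment> \<open>The \<xi> multiples of the modified traces inside A and B cancel those
    subtracted from \<open>Um\<close> and \<open>Up\<close>. A supplies strict positivity; all other
    summands are semidefinite.\<close>
  then have "U_new D dt j = A + (B + (c * w 1) *\<^sub>R (Um - \<xi>m *\<^sub>R Uhat_minus D j)
      + (c * w 1) *\<^sub>R (Up - \<xi>p *\<^sub>R Uhat_plus D (j - 1)) + c *\<^sub>R I
      + dt *\<^sub>R (\<beta> *\<^sub>R U_avg D j + (\<Sum>\<mu>=1..gauss_num D. gauss_wt D \<mu> *\<^sub>R src \<mu>))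
      + dt *\<^sub>R (\<beta>' *\<^sub>R U_avg D j + alpha11 D j *\<^sub>R S1 (U_avg D j)))"
    by (simp add: U_new_def src A_def B_def \<tau>_def h_def algebra_simps)
  also have "\<dots> \<in> admissible"
    using c w1 dt A nonneg_state_admissible[OF B] \<xi>m(2) \<xi>p(2) I
    by (intro src1 src2 admissible_add nonneg_state_add nonneg_state_scaleR) auto
  finally show "U_new D dt j \<in> admissible" .
qed

end
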